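(* Let $m,n\ge 2$ be natural numbers with $n=k(m-1)+m$ for some integer $k\ge 1$, and let $G\le\operatorname{Sym}(m)$. Let $H=G_{ext}\le\operatorname{Sym}(n)$ be the extended group of $G$, consisting of the permutations of $\{0,\dots,n-1\}$ that act as an element of $G$ on $\{0,\dots,m-1\}$ and as the identity on $\{m,\dots,n-1\}$. Then $V_m(G)$ embeds (as a group) in $V_n(H)$.
   Context: For $r\ge 2$ let $\mathcal{A}_r=\{0,1,\dots,r-1\}$, let $\mathcal{A}_r^*$ be the set of finite words over $\mathcal{A}_r$ (including the empty word), and let $\mathfrak{C}_r=\mathcal{A}_r^{\mathbb{N}}$ (infinite words, product topology). For $u\in\mathcal{A}_r^*$ and $v$ a finite or infinite word, $uv$ denotes concatenation, and $u\le_{pref} v$ means $v=uw$ for some word $w$. A (complete) prefix code of $\mathfrak{C}_r$ is a finite set $S\subset\mathcal{A}_r^*$ such that every $\zeta\in\mathfrak{C}_r$ has exactly one $s\in S$ with $s\le_{pref}\zeta$. A permutation $\sigma\in\operatorname{Sym}(r)$ acts on words letterwise: $\sigma(z_1z_2\cdots)=\sigma(z_1)\sigma(z_2)\cdots$. For $H\le\operatorname{Sym}(r)$, the symmetric Thompson group $V_r(H)$ is the group (under composition) of homeomorphisms of $\mathfrak{C}_r$ described by tables: two prefix codes $P=\{p_1,\dots,p_k\}$ and $Q=\{q_1,\dots,q_k\}$ of $\mathfrak{C}_r$ of the same size together with $\sigma_i,\tau_i\in H$, describing the homeomorphism $p_i\,\sigma_i(u)\mapsto q_i\,\tau_i(u)$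 for all $u\in\mathfrak{C}_r$ and all $i$. *)

theory Defs
  imports "HOL-Algebra.Bij" "HOL-Library.FuncSet"
begin

definition cantor :: "nat \<Rightarrow> (nat \<Rightarrow> nat) set" where
  "cantor r = {\<zeta>. \<forall>i. \<zeta> i < r}"

definition fin_words :: "nat \<Rightarrow> nat list set" where
  "fin_words r = {w. set w \<subseteq> {..<r}}"

definition conc :: "nat list \<Rightarrow> (nat \<Rightarrow> nat) \<Rightarrow> (nat \<Rightarrow> nat)" where
  "conc w \<zeta> = (\<lambda>i. if i < length w then w ! i else \<zeta> (i - length w))"

definition pref :: "nat list \<Rightarrow> (nat \<Rightarrow> nat) \<Rightarrow> bool" where
  "pref w \<zeta> \<longleftrightarrow> (\<forall>i<length w. w ! i = \<zeta> i)"

definition prefix_code :: "nat \<Rightarrow> nat list set \<Rightarrow> bool" where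
  "prefix_code r S \<longleftrightarrow> finite S \<and> S \<subseteq> fin_words r \<and>
     (\<forall>\<zeta>\<in>cantor r. \<exists>!s. s \<in> S \<and> pref s \<zeta>)"

text \<open>Sym(r) is BijGroup {..<r}; a permutation acts letterwise on words.\<close>

definition Vset :: "nat \<Rightarrow> (nat \<Rightarrow> nat) set \<Rightarrow> ((nat \<Rightarrow> nat) \<Rightarrow> (nat \<Rightarrow> nat)) set" where
  "Vset r H = {f. f \<in> extensional (cantor r) \<and>
     (\<exists>ps qs :: nat list list. \<exists>sigs taus :: (nat \<Rightarrow> nat) list.
        length qs = length ps \<and> length sigs = length ps \<and> length taus = length ps \<and>
        distinct ps \<and> distinct qs \<and>
        prefix_code r (set ps) \<and> prefix_code r (set qs) \<and>
        set sigs \<subseteq> H \<and> set taus \<subseteq> H \<and>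
        (\<forall>i<length ps. \<forall>u\<in>cantor r.
           f (conc (ps ! i) ((sigs ! i) \<circ> u)) = conc (qs ! i) ((taus ! i) \<circ> u)))}"

definition Vgroup :: "nat \<Rightarrow> (nat \<Rightarrow> nat) set \<Rightarrow> ((nat \<Rightarrow> nat) \<Rightarrow> (nat \<Rightarrow> nat)) monoid" where
  "Vgroup r H = \<lparr>carrier = Vset r H,
                  mult = (\<lambda>f g. compose (cantor r) f g),
                  one = (\<lambda>\<zeta>\<in>cantor r. \<zeta>)\<rparr>"

definition ext_group :: "nat \<Rightarrow> nat \<Rightarrow> (nat \<Rightarrow> nat) set \<Rightarrow> (nat \<Rightarrow> nat) set" where
  "ext_group m n G = {\<tau> \<in> Bij {..<n}.
      (\<exists>\<sigma>\<in>G. \<forall>i<m. \<tau> i = \<sigma> i) \<and> (\<forall>i. m \<le> i \<and> i < n \<longrightarrow> \<tau> i = i)}"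

end

theory Submission
  imports Defs
begin

text \<open>
  An element \<open>f\<close> of \<open>V_m(G)\<close> lifts along \<open>G \<times> C_m \<rightarrow> C_m, (g, y) \<mapsto> g(y)\<close>: writing the rows of a
  table as \<open>g(w v) \<mapsto> h(w' v)\<close>, the lift is \<open>(g, w v) \<mapsto> (h, w' v)\<close>, a prefix replacement
  in which the permutations only survive as a finite label. The factor \<open>C_m\<close> may be
  replaced by any space \<open>Y\<close> that is a disjoint union of \<open>m\<close> copies of itself. A disjoint
  union of \<open>n - 1\<close> cones of \<open>C_n\<close> is such a space, by prefix replacements, because
  expanding \<open>m - 1\<close> cones yields \<open>m (n - 1)\<close> of them. Coding the labels by words of length
  \<open>m\<close> places \<open>G \<times> Y\<close> inside \<open>C_n\<close>, and extending by the identity embeds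
  \<open>V_m(G)\<close> already into \<open>V_n\<close> of the trivial group.
\<close>

section \<open>Words\<close>

lemma conc_append: "conc (v @ w) z = conc v (conc w z)"
  by (rule ext) (auto simp: conc_def nth_append)

lemma conc_Nil [simp]: "conc [] z = z"
  by (simp add: conc_def)

lemma conc_Cons_0 [simp]: "conc (a # w) z 0 = a"
  by (simp add: conc_def)

lemma conc_Cons_Suc [simp]: "conc (a # w) z (Suc i) = conc w z i"
  by (simp add: conc_def)

lemma conc_shift_Suc: "conc [y 0] (\<lambda>i. y (Suc i)) = y"
proof
  show "conc [y 0] (\<lambda>i. y (Suc i)) i = y i" for i
    by (cases i) auto
qed

lemma conc_nth: "i < length w \<Longrightarrow> conc w z i = w ! i"
  by (simp add: conc_def)

lemma conc_shift: "conc w z (i + length w) = z i"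
  by (simp add: conc_def)

lemma comp_conc: "g \<circ> conc w z = conc (map g w) (g \<circ> z)"
  by (rule ext) (auto simp: conc_def)

lemma pref_iff: "pref w z \<longleftrightarrow> z = conc w (\<lambda>i. z (i + length w))"
proof
  assume "pref w z"
  then show "z = conc w (\<lambda>i. z (i + length w))"
    by (intro ext) (auto simp: pref_def conc_def)
next
  assume "z = conc w (\<lambda>i. z (i + length w))"
  then show "pref w z"
    unfolding pref_def by (metis conc_nth)
qed

lemma pref_conc: "pref w (conc w z)"
  by (simp add: pref_def conc_nth)

lemma conc_inject:
  assumes "conc v y = conc w z" "length v = length w"
  shows "v = w \<and> y = z"
proof
  show "v = w"
    using assms by (metis conc_nth nth_equalityI)
  show "y = z"
    using assms by (metis conc_shift ext)
qed

lemma pref_take: "pref w z \<Longrightarrow> w = map z [0..<length w]"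
  by (auto simp: pref_def intro: nth_equalityI)

lemma pref_prefix_extend:
  assumes "pref v z" "pref w z" "length v \<le> length w"
  obtains u where "w = v @ u"
proof -
  have "w = map z [0..<length v] @ map z [length v..<length w]"
    using pref_take[OF assms(2)] assms(3)
    by (metis le_add_diff_inverse map_append plus_nat.add_0 upt_add_eq_append zero_le)
  then show ?thesis
    using that pref_take[OF assms(1)] by metis
qed

lemma conc_in_cantor_iff: "conc w z \<in> cantor r \<longleftrightarrow> w \<in> fin_words r \<and> z \<in> cantor r"
proof
  assume A: "conc w z \<in> cantor r"
  have "w ! i < r" if "i < length w" for i
    using A that conc_nth[OF that, of z] unfolding cantor_def by (metis mem_Collect_eq)
  moreover have "z i < r" for i
    using A conc_shift[of w z i] unfolding cantor_def by (metis mem_Collect_eq)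
  ultimately show "w \<in> fin_words r \<and> z \<in> cantor r"
    by (auto simp: fin_words_def cantor_def in_set_conv_nth)
qed (auto simp: cantor_def fin_words_def conc_def dest: nth_mem)

lemma shift_in_cantor: "z \<in> cantor r \<Longrightarrow> (\<lambda>i. z (i + j)) \<in> cantor r"
  by (simp add: cantor_def)

lemma shift_Suc_in_cantor: "z \<in> cantor r \<Longrightarrow> (\<lambda>i. z (Suc i)) \<in> cantor r"
  by (simp add: cantor_def)

lemma cantor_less: "z \<in> cantor r \<Longrightarrow> z i < r"
  by (simp add: cantor_def)

lemma take_in_fin_words: "z \<in> cantor r \<Longrightarrow> map z [0..<j] \<in> fin_words r"
  by (auto simp: cantor_def fin_words_def)

lemma fin_words_append [simp]:
  "v @ w \<in> fin_words r \<longleftrightarrow> v \<in> fin_words r \<and> w \<in> fin_words r"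
  by (auto simp: fin_words_def)

lemma fin_words_Cons [simp]: "a # w \<in> fin_words r \<longleftrightarrow> a < r \<and> w \<in> fin_words r"
  by (auto simp: fin_words_def)

lemma fin_words_Nil [simp]: "[] \<in> fin_words r"
  by (simp add: fin_words_def)

lemma zero_in_cantor: "0 < r \<Longrightarrow> (\<lambda>_. 0) \<in> cantor r"
  by (simp add: cantor_def)


section \<open>Local prefix replacements are given by tables\<close>

text \<open>Compactness of the Cantor space, in the form of Koenig's lemma.\<close>

lemma uniform_prefix_length:
  fixes D :: "nat list set"
  assumes ext: "\<And>w a. w \<in> D \<Longrightarrow> a < r \<Longrightarrow> w @ [a] \<in> D"
    and cover: "\<And>z. z \<in> cantor r \<Longrightarrow> \<exists>w\<in>D. pref w z"
  shows "\<exists>L. \<forall>w\<in>fin_words r. length w = L \<longrightarrow> w \<in> D"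
proof (rule ccontr)
  have ext': "w @ v \<in> D" if "w \<in> D" "v \<in> fin_words r" for v w
    using that(2)
  proof (induction v rule: rev_induct)
    case (snoc a v)
    then show ?case using ext[of "w @ v" a] by simp
  qed (use that in simp)
  \<comment> \<open>A word is bad if no single length suffices below it. Every bad word has a bad
    child, so a bad empty word starts an infinite bad branch, and the covering hypothesis fails
    along it.\<close>
  define bad where
    "bad w \<longleftrightarrow> (\<forall>L. \<exists>v\<in>fin_words r. length v = L \<and> w @ v \<notin> D)" for w
  assume "\<not> ?thesis"
  then have bad0: "bad []" unfolding bad_def by auto
  have step: "\<exists>a<r. bad (w @ [a])" if "bad w" for w
  proof (rule ccontr)
    assume "\<not> (\<exists>a<r. bad (w @ [a]))"
    then have "\<forall>a<r. \<exists>L. \<forall>v\<in>fin_words r. length v = L \<longrightarrow> w @ a # v \<in> D"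
      unfolding bad_def by auto
    then obtain L where L: "\<And>a v. a < r \<Longrightarrow> v \<in> fin_words r \<Longrightarrow> length v = L a \<Longrightarrow> w @ a # v \<in> D"
      by metis
    \<comment> \<open>The alphabet is finite, so the bounds of the children have a maximum; the
      extra letter in \<open>Suc M\<close> is the step from \<open>w\<close> to a child.\<close>
    define M where "M = Max (L ` {..<r})"
    have M: "L a \<le> M" if "a < r" for a
      unfolding M_def using that by (intro Max_ge) auto
    obtain v where v: "v \<in> fin_words r" "length v = Suc M" "w @ v \<notin> D"
      using \<open>bad w\<close> unfolding bad_def by blast
    obtain a v' where av: "v = a # v'" using v(2) by (cases v) auto
    have a: "a < r" "v' \<in> fin_words r" using v(1) av by auto
    have sub: "take (L a) v' \<in> fin_words r" "drop (L a) v' \<in> fin_words r"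
      using a(2) append_take_drop_id[of "L a" v'] fin_words_append by metis+
    have "w @ a # take (L a) v' \<in> D"
      using L[OF a(1) sub(1)] M[OF a(1)] v(2) av by simp
    from ext'[OF this sub(2)] show False using v(3) av by simp
  qed
  obtain W where W: "\<And>i. bad (W i)" "\<And>i. \<exists>a<r. W (Suc i) = W i @ [a]" "W 0 = []"
  proof -
    have "\<exists>W. (\<forall>i. bad (W i) \<and> (i = 0 \<longrightarrow> W i = [])) \<and> (\<forall>i. \<exists>a<r. W (Suc i) = W i @ [a])"
      using dependent_nat_choice[of "\<lambda>i w. bad w \<and> (i = 0 \<longrightarrow> w = [])"
          "\<lambda>_ w w'. \<exists>a<r. w' = w @ [a]"] bad0 step by blast
    then show ?thesis using that by blast
  qed
  then obtain z where z: "\<And>i. z i < r" "\<And>i. W (Suc i) = W i @ [z i]" by metis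
  have Wz: "W i = map z [0..<i]" for i
    by (induction i) (use W z in auto)
  have "z \<in> cantor r" using z by (simp add: cantor_def)
  from cover[OF this] obtain w where w: "w \<in> D" "pref w z" by blast
  have "W (length w) \<in> D" using Wz pref_take[OF w(2)] w(1) by metis
  then show False using W(1)[of "length w"] ext' unfolding bad_def by blast
qed

text \<open>Compactness gives one length \<open>L\<close> at which \<open>f\<close> is a prefix
  replacement on every cone, so the words of length \<open>L\<close> serve as the domain code.
  Bijectivity of \<open>f\<close> makes their images a code. All rows carry the identity
  permutation.\<close>

lemma Vset_if_local:
  assumes r: "0 < r" and ext: "f \<in> extensional (cantor r)"
    and bij: "bij_betw f (cantor r) (cantor r)"
    and one: "(\<lambda>i\<in>{..<r}. i) \<in> H"
    and loc: "\<And>z. z \<in> cantor r \<Longrightarrow>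
      \<exists>p q. pref p z \<and> (\<forall>u\<in>cantor r. f (conc p u) = conc q u)"
  shows "f \<in> Vset r H"
proof -
  define D where "D = {p. \<exists>q. \<forall>u\<in>cantor r. f (conc p u) = conc q u}"
  have "\<exists>L. \<forall>w\<in>fin_words r. length w = L \<longrightarrow> w \<in> D"
  proof (rule uniform_prefix_length)
    fix w a assume "w \<in> D" "a < r"
    then obtain q where q: "\<And>u. u \<in> cantor r \<Longrightarrow> f (conc w u) = conc q u"
      unfolding D_def by blast
    have "f (conc (w @ [a]) u) = conc (q @ [a]) u" if "u \<in> cantor r" for u
      using q[of "conc [a] u"] that \<open>a < r\<close> by (simp add: conc_append conc_in_cantor_iff)
    then show "w @ [a] \<in> D" unfolding D_def by blast
  qed (use loc D_def in blast)
  then obtain L where L: "\<And>w. w \<in> fin_words r \<Longrightarrow> length w = L \<Longrightarrow> w \<in> D" by blast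
  define ps where "ps = List.n_lists L [0..<r]"
  have ps: "set ps = {w \<in> fin_words r. length w = L}"
    unfolding ps_def set_n_lists fin_words_def by auto
  have "\<forall>p\<in>set ps. \<exists>q. \<forall>u\<in>cantor r. f (conc p u) = conc q u"
    using L unfolding ps D_def by blast
  then obtain q where q: "\<And>p u. p \<in> set ps \<Longrightarrow> u \<in> cantor r \<Longrightarrow> f (conc p u) = conc (q p) u"
    by metis
  have split: "\<exists>p\<in>set ps. \<exists>u\<in>cantor r. z = conc p u" if "z \<in> cantor r" for z
  proof -
    let ?p = "map z [0..<L]"
    have "pref ?p z" by (simp add: pref_def)
    then have "z = conc ?p (\<lambda>i. z (i + L))" by (simp add: pref_iff)
    then show ?thesis
      using take_in_fin_words[OF that, of L] shift_in_cantor[OF that, of L]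
      by (intro bexI[of _ ?p] bexI[of _ "\<lambda>i. z (i + L)"]) (auto simp: ps)
  qed
  have mem: "conc p u \<in> cantor r" if "p \<in> set ps" "u \<in> cantor r" for p u
    using that by (simp add: conc_in_cantor_iff ps)
  \<comment> \<open>Different rows have disjoint images, since \<open>f\<close> is injective and two
    prefixes of equal length of one word agree. This gives distinctness and uniqueness for the range
    code.\<close>
  have inj: "p = p'" if "p \<in> set ps" "p' \<in> set ps" "u \<in> cantor r" "u' \<in> cantor r"
    "conc (q p) u = conc (q p') u'" for p p' u u'
  proof -
    have "conc p u = conc p' u'"
      using that q mem bij_betw_imp_inj_on[OF bij] by (metis inj_onD)
    then show ?thesis using conc_inject that(1,2) ps by auto
  qed
  have qfin: "q p \<in> fin_words r" if "p \<in> set ps" for p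
    using q[OF that zero_in_cantor[OF r]] mem[OF that zero_in_cantor[OF r]] bij
    by (metis bij_betwE conc_in_cantor_iff)
  have P: "prefix_code r (set ps)"
    unfolding prefix_code_def
  proof (intro conjI ballI)
    fix z assume "z \<in> cantor r"
    then show "\<exists>!s. s \<in> set ps \<and> pref s z"
      using split[of z] pref_take by (auto simp: ps pref_conc) (metis pref_take)
  next
    show "finite (set ps)" by simp
  qed (auto simp: ps)
  have Q: "prefix_code r (set (map q ps))"
    unfolding prefix_code_def
  proof (intro conjI ballI)
    fix z assume z: "z \<in> cantor r"
    then obtain x where x: "x \<in> cantor r" "z = f x"
      using bij by (metis bij_betw_imp_surj_on imageE)
    obtain p u where pu: "p \<in> set ps" "u \<in> cantor r" "x = conc p u"
      using split[OF x(1)] by blast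
    show "\<exists>!s. s \<in> set (map q ps) \<and> pref s z"
    proof (rule ex1I[of _ "q p"])
      show "q p \<in> set (map q ps) \<and> pref (q p) z"
        using pu x q by (simp add: pref_conc)
      fix s assume s: "s \<in> set (map q ps) \<and> pref s z"
      then obtain p' where p': "p' \<in> set ps" "s = q p'" by auto
      have "conc (q p) u = conc (q p') (\<lambda>i. z (i + length s))"
        using s p' pu x q by (metis pref_iff)
      then show "s = q p"
        using inj[OF pu(1) p'(1) pu(2) shift_in_cantor[OF z]] p' by blast
    qed
  qed (use qfin in auto)
  have dq: "distinct (map q ps)"
    unfolding distinct_map ps_def[symmetric]
    using inj[OF _ _ zero_in_cantor[OF r] zero_in_cantor[OF r]]
    by (auto intro!: inj_onI simp: ps_def distinct_n_lists)
  let ?e = "replicate (length ps) (\<lambda>i\<in>{..<r}. i)"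
  have e: "(\<lambda>i\<in>{..<r}. i) \<circ> u = u" if "u \<in> cantor r" for u
    using that by (auto simp: cantor_def)
  show ?thesis
    unfolding Vset_def
    by (rule CollectI, rule conjI[OF ext], rule exI[of _ ps], rule exI[of _ "map q ps"],
        rule exI[of _ ?e], rule exI[of _ ?e])
      (use P Q dq one q e in \<open>auto simp: ps_def distinct_n_lists\<close>)
qed


section \<open>Branching maps\<close>

definition stump :: "nat \<Rightarrow> (nat \<Rightarrow> nat) set" where
  "stump n = {y \<in> cantor n. y 0 \<noteq> n - 1}"

text \<open>
  The stump is the union of the cones of the letters \<open>0, \<dots>, n - 2\<close>. Expanding the first
  \<open>m - 1\<close> of them gives, for each \<open>a < m - 1\<close>, a copy of the stump inside the cone of \<open>a\<close>;
  the left-over cones of \<open>[a, n - 1]\<close> and of the unexpanded letters form the \<open>m\<close>-th copy.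
\<close>

definition branch :: "nat \<Rightarrow> nat \<Rightarrow> nat \<Rightarrow> (nat \<Rightarrow> nat) \<Rightarrow> (nat \<Rightarrow> nat)" where
  "branch m n a y =
     (if a < m - 1 then conc [a] y
      else if y 0 < m - 1 then conc [y 0, n - 1] (\<lambda>i. y (Suc i)) else y)"

text \<open>Points of the stump never begin with \<open>n - 1\<close>, so \<open>n - 1\<close> after
  a first letter below \<open>m - 1\<close> marks a left-over cone, which belongs to the
  \<open>m\<close>-th copy. \<open>branch_rest\<close> deletes this marker.\<close>

definition branch_letter :: "nat \<Rightarrow> nat \<Rightarrow> (nat \<Rightarrow> nat) \<Rightarrow> nat" where
  "branch_letter m n y = (if y 0 < m - 1 \<and> y 1 \<noteq> n - 1 then y 0 else m - 1)"

definition branch_rest :: "nat \<Rightarrow> nat \<Rightarrow> (nat \<Rightarrow> nat) \<Rightarrow> (nat \<Rightarrow> nat)" where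
  "branch_rest m n y =
     (if y 0 < m - 1
      then if y 1 = n - 1 then conc [y 0] (\<lambda>i. y (i + 2)) else (\<lambda>i. y (Suc i))
      else y)"

locale thompson_embedding =
  fixes m n :: nat and G :: "(nat \<Rightarrow> nat) set"
  assumes two_le_m: "2 \<le> m" and m_le_n: "m \<le> n" and subgroup_G: "subgroup G (BijGroup {..<m})"
begin

abbreviation Y where "Y \<equiv> stump n"

abbreviation branches :: "nat list \<Rightarrow> (nat \<Rightarrow> nat) \<Rightarrow> (nat \<Rightarrow> nat)" where
  "branches \<equiv> foldr (branch m n)"

lemma branch_in: "y \<in> Y \<Longrightarrow> a < m \<Longrightarrow> branch m n a y \<in> Y"
  using two_le_m m_le_n
  by (auto simp: stump_def branch_def conc_in_cantor_iff cantor_less shift_Suc_in_cantor)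

lemma branch_letter_branch: "y \<in> Y \<Longrightarrow> a < m \<Longrightarrow> branch_letter m n (branch m n a y) = a"
  using two_le_m m_le_n by (auto simp: branch_letter_def branch_def stump_def)

lemma branch_rest_branch: "y \<in> Y \<Longrightarrow> a < m \<Longrightarrow> branch_rest m n (branch m n a y) = y"
  using two_le_m m_le_n conc_shift_Suc[of y]
  by (auto simp: branch_rest_def branch_def stump_def)

lemma branch_letter_less: "branch_letter m n y < m"
  using two_le_m by (auto simp: branch_letter_def)

lemma branch_rest_in: "y \<in> Y \<Longrightarrow> branch_rest m n y \<in> Y"
  using shift_in_cantor[of y n 2]
  by (auto simp: branch_rest_def stump_def conc_in_cantor_iff cantor_less shift_Suc_in_cantor)

text \<open>Surjectivity of the branching maps taken together: with the two inverse laws above,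
  \<open>Y\<close> is the disjoint union of its \<open>m\<close> copies.\<close>

lemma branch_letter_rest:
  assumes "y \<in> Y"
  shows "branch m n (branch_letter m n y) (branch_rest m n y) = y"
proof (cases "y 0 < m - 1 \<and> y 1 = n - 1")
  case True
  have "conc [y 0, n - 1] (\<lambda>i. y (i + 2)) i = y i" for i
    using True by (cases i; cases "i - 1") auto
  then show ?thesis
    using True by (auto simp: branch_def branch_letter_def branch_rest_def fun_eq_iff)
next
  case False
  then show ?thesis
    using conc_shift_Suc[of y] by (auto simp: branch_def branch_letter_def branch_rest_def)
qed

section \<open>Words of branching maps acting on the stump\<close>

lemma branches_in: "y \<in> Y \<Longrightarrow> w \<in> fin_words m \<Longrightarrow> branches w y \<in> Y"
  by (induction w) (auto intro: branch_in)

lemma branch_inject: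
  assumes "branch m n a y = branch m n a' y'" "y \<in> Y" "y' \<in> Y" "a < m" "a' < m"
  shows "a = a' \<and> y = y'"
  using assms branch_letter_branch branch_rest_branch by metis

text \<open>The copies are disjoint and the branching maps injective on \<open>Y\<close>, so outer
  letters cancel one by one, as for two prefixes of one infinite word.\<close>

lemma branches_comparable:
  assumes "branches v y = branches w z" "y \<in> Y" "z \<in> Y" "v \<in> fin_words m" "w \<in> fin_words m"
    and "length v \<le> length w"
  obtains u where "w = v @ u" "y = branches u z" "u \<in> fin_words m"
proof -
  have "\<exists>u. w = v @ u \<and> y = branches u z \<and> u \<in> fin_words m"
    using assms
  proof (induction v arbitrary: w)
    case (Cons a v)
    then obtain b w' where w: "w = b # w'" by (cases w) auto
    then have "a = b \<and> branches v y = branches w' z"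
      using Cons.prems by (intro branch_inject) (auto intro: branches_in)
    then show ?case using Cons.IH[of w'] Cons.prems w by auto
  qed simp
  then show ?thesis using that by blast
qed

lemma Y_point: "(\<lambda>_. 0) \<in> Y"
  using two_le_m m_le_n by (auto simp: stump_def cantor_def)

text \<open>A nonempty word maps \<open>Y\<close> into the copy of its first letter, so it moves any
  point of another copy; one exists as \<open>m \<ge> 2\<close>.\<close>

lemma branches_fixing_Y:
  assumes "\<And>y. y \<in> Y \<Longrightarrow> branches u y = y" "u \<in> fin_words m"
  shows "u = []"
proof (cases u)
  case (Cons a u')
  define b where "b = (if a = 0 then 1 else 0 :: nat)"
  have b: "b < m" "b \<noteq> a" "a < m" "u' \<in> fin_words m"
    using two_le_m assms(2) Cons by (auto simp: b_def)
  let ?y = "branch m n b (\<lambda>_. 0)"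
  have "?y \<in> Y" using branch_in Y_point b by blast
  then have "branch m n a (branches u' ?y) = ?y" using assms(1)[of ?y] Cons by simp
  then show ?thesis
    using branch_inject[of a "branches u' ?y" b "\<lambda>_. 0"] b Y_point branches_in \<open>?y \<in> Y\<close> by blast
qed simp

text \<open>Cancelling the shorter word leaves a word that fixes \<open>Y\<close> pointwise. This
  faithfulness later makes the lift injective.\<close>

lemma branches_eqD:
  assumes "\<And>y. y \<in> Y \<Longrightarrow> branches v y = branches w y" "v \<in> fin_words m" "w \<in> fin_words m"
  shows "v = w"
proof -
  have *: "v = w" if le: "length v \<le> length w" and vw: "\<And>y. y \<in> Y \<Longrightarrow> branches v y = branches w y"
    "v \<in> fin_words m" "w \<in> fin_words m" for v w
  proof -
    obtain u where u: "w = v @ u" "u \<in> fin_words m"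
      using branches_comparable[OF vw(1)[OF Y_point] Y_point Y_point vw(2,3) le]
      by blast
    have "branches u y = y" if "y \<in> Y" for y
      using branches_comparable[OF vw(1)[OF that] that that vw(2,3) le] u
      by (metis same_append_eq)
    then show ?thesis using branches_fixing_Y u by simp
  qed
  show ?thesis
  proof (cases "length v \<le> length w")
    case True
    then show ?thesis using * assms by blast
  next
    case False
    then have "w = v" using assms by (intro *) auto
    then show ?thesis ..
  qed
qed

lemma branches_itinerary:
  assumes "y \<in> Y"
  obtains z where "z \<in> cantor m" "\<And>w. pref w z \<Longrightarrow> \<exists>y'\<in>Y. y = branches w y'"
proof -
  \<comment> \<open>The \<open>i\<close>-th letter names the copy reached after undoing
    \<open>i\<close> branchings; this address need not determine \<open>y\<close>.\<close>
  define z where "z i = branch_letter m n ((branch_rest m n ^^ i) y)" for i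
  have rest: "(branch_rest m n ^^ i) y \<in> Y" for i
    by (induction i) (auto intro: assms branch_rest_in)
  have "branches (map z [0..<j]) ((branch_rest m n ^^ j) y) = y" for j
  proof (induction j)
    case (Suc j)
    then show ?case using branch_letter_rest[OF rest[of j]] by (simp add: z_def)
  qed simp
  then have "\<exists>y'\<in>Y. y = branches w y'" if "pref w z" for w
    using pref_take[OF that] rest by metis
  moreover have "z \<in> cantor m" by (simp add: z_def cantor_def branch_letter_less)
  ultimately show ?thesis using that by blast
qed

text \<open>\<open>branch\<close> tests only the first letter of its argument. The target has the
  form \<open>d # t\<close> so that this letter stays visible through the induction.\<close>

lemma branches_prefix_replacement:
  assumes "c < n - 1" "w \<in> fin_words m"
  shows "\<exists>d t. \<forall>u\<in>cantor n. branches w (conc [c] u) = conc (d # t) u"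
  using assms
proof (induction w)
  case Nil
  then show ?case by auto
next
  case (Cons a w)
  then obtain d t where dt: "\<And>u. u \<in> cantor n \<Longrightarrow> branches w (conc [c] u) = conc (d # t) u"
    by auto
  have "branch m n a (conc (d # t) u) =
    conc (if a < m - 1 then a # d # t else if d < m - 1 then d # (n - 1) # t else d # t) u" for u
    by (simp add: branch_def flip: conc_append)
  then show ?case
    using dt by (auto split: if_splits)
qed


section \<open>Letterwise action of the permutation group\<close>

lemma G_Bij: "g \<in> G \<Longrightarrow> g \<in> Bij {..<m}"
  using subgroup.subset[OF subgroup_G] by (auto simp: BijGroup_def)

lemma G_bij: "g \<in> G \<Longrightarrow> bij_betw g {..<m} {..<m}"
  using G_Bij by (auto simp: Bij_def)

lemma G_less: "g \<in> G \<Longrightarrow> i < m \<Longrightarrow> g i < m"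
  using G_bij bij_betwE by (metis lessThan_iff)

lemma G_inject: "g \<in> G \<Longrightarrow> i < m \<Longrightarrow> j < m \<Longrightarrow> g i = g j \<Longrightarrow> i = j"
  using bij_betw_imp_inj_on[OF G_bij, of g] by (auto dest: inj_onD)

lemma G_eqI: "g \<in> G \<Longrightarrow> h \<in> G \<Longrightarrow> (\<And>i. i < m \<Longrightarrow> g i = h i) \<Longrightarrow> g = h"
  using Bij_imp_extensional[OF G_Bij] by (intro extensionalityI[of g "{..<m}" h]) auto

lemma one_in_G: "(\<lambda>i\<in>{..<m}. i) \<in> G"
  using subgroup.one_closed[OF subgroup_G] by (simp add: BijGroup_def)

lemma one_comp: "z \<in> cantor m \<Longrightarrow> (\<lambda>i\<in>{..<m}. i) \<circ> z = z"
  by (auto simp: cantor_def)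

lemma compose_in_G: "g \<in> G \<Longrightarrow> h \<in> G \<Longrightarrow> compose {..<m} g h \<in> G"
  using subgroup.m_closed[OF subgroup_G, of g h] G_Bij by (simp add: BijGroup_def)

lemma inverse_in_G:
  assumes "g \<in> G"
  obtains g' where "g' \<in> G" "\<And>i. i < m \<Longrightarrow> g (g' i) = i"
proof -
  let ?g = "\<lambda>i\<in>{..<m}. inv_into {..<m} g i"
  have "?g \<in> G"
    using subgroup.m_inv_closed[OF subgroup_G assms] inv_BijGroup[OF G_Bij[OF assms]] by simp
  moreover have "g (?g i) = i" if "i < m" for i
    using that G_bij[OF assms] by (simp add: bij_betw_inv_into_right)
  ultimately show ?thesis using that by blast
qed

lemma G_comp_cantor: "g \<in> G \<Longrightarrow> z \<in> cantor m \<Longrightarrow> g \<circ> z \<in> cantor m"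
  by (simp add: cantor_def G_less)

lemma G_comp_inject:
  assumes "g \<in> G" "y \<in> cantor m" "z \<in> cantor m" "g \<circ> y = g \<circ> z"
  shows "y = z"
proof
  fix i
  have "g (y i) = g (z i)" using assms(4) by (metis comp_apply)
  then show "y i = z i" using assms(1-3) by (auto simp: cantor_def dest: G_inject)
qed

lemma G_map_surj:
  assumes "g \<in> G" "w \<in> fin_words m"
  obtains v where "v \<in> fin_words m" "map g v = w"
proof -
  obtain g' where g': "g' \<in> G" "\<And>i. i < m \<Longrightarrow> g (g' i) = i"
    using inverse_in_G[OF assms(1)] by blast
  have "map g (map g' w) = w"
    using assms(2) g'(2) by (auto simp: fin_words_def intro!: map_idI)
  moreover have "map g' w \<in> fin_words m"
    using assms(2) G_less[OF g'(1)] by (auto simp: fin_words_def)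
  ultimately show ?thesis using that by blast
qed

text \<open>Take \<open>h = t s^{-1} g\<close> and \<open>u = s^{-1} g v\<close>. This replaces the
  input permutation \<open>s\<close> of a row by a prescribed \<open>g\<close>.\<close>

lemma G_transport:
  assumes "g \<in> G" "s \<in> G" "t \<in> G"
  obtains h where "h \<in> G"
    "\<And>v. v \<in> cantor m \<Longrightarrow> \<exists>u\<in>cantor m. g \<circ> v = s \<circ> u \<and> h \<circ> v = t \<circ> u"
proof -
  obtain s' where s': "s' \<in> G" "\<And>i. i < m \<Longrightarrow> s (s' i) = i"
    using inverse_in_G[OF assms(2)] by blast
  let ?h = "compose {..<m} t (compose {..<m} s' g)"
  have "\<exists>u\<in>cantor m. g \<circ> v = s \<circ> u \<and> ?h \<circ> v = t \<circ> u" if "v \<in> cantor m" for v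
    using that s' assms
    by (intro bexI[of _ "s' \<circ> (g \<circ> v)"] G_comp_cantor)
      (auto simp: fun_eq_iff compose_def cantor_def G_less)
  moreover have "?h \<in> G" by (intro compose_in_G s'(1) assms)
  ultimately show ?thesis using that[of ?h] by blast
qed

lemma G_comp_surj:
  assumes "g \<in> G" "z \<in> cantor m"
  obtains u where "u \<in> cantor m" "z = g \<circ> u"
  using G_transport[OF one_in_G assms(1) assms(1)] assms(2) one_comp by metis


section \<open>Rows of a table\<close>

text \<open>
  A row \<open>p \<sigma>(u) \<mapsto> q \<tau>(u)\<close> is normalised to \<open>g(w v) \<mapsto> h(w' v)\<close>, with the permutations
  also acting on the prefixes; \<open>g\<close> can then be prescribed.
\<close>

definition row :: "((nat \<Rightarrow> nat) \<Rightarrow> (nat \<Rightarrow> nat)) \<Rightarrow> (nat \<Rightarrow> nat) \<Rightarrow> nat list \<Rightarrow>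
    (nat \<Rightarrow> nat) \<Rightarrow> nat list \<Rightarrow> bool" where
  "row f g w h w' \<longleftrightarrow> g \<in> G \<and> h \<in> G \<and> w \<in> fin_words m \<and> w' \<in> fin_words m \<and>
     (\<forall>v\<in>cantor m. f (g \<circ> conc w v) = h \<circ> conc w' v)"

text \<open>The labels act on prefixes as well, so subdividing a row appends the same word on both
  sides and keeps both labels.\<close>

lemma row_extend: "row f g w h w' \<Longrightarrow> v \<in> fin_words m \<Longrightarrow> row f g (w @ v) h (w' @ v)"
  by (auto simp: row_def conc_append conc_in_cantor_iff)

lemma row_compose:
  "row f g w h w' \<Longrightarrow> row f' h w' l w'' \<Longrightarrow> row (compose (cantor m) f' f) g w l w''"
  by (auto simp: row_def compose_def conc_in_cantor_iff G_comp_cantor)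

text \<open>If one output prefix were longer, some letter would be constant on one side and range
  over all values of an injective label on the other. With equal lengths, constant tails recover the
  label and then the prefix.\<close>

lemma row_unique:
  assumes "row f g w h w'" "row f g w k v'"
  shows "h = k \<and> w' = v'"
proof -
  have le: "length v' \<le> length w'" if R: "row f g w h w'" "row f g w k v'" for h k w' v'
  proof (rule ccontr)
    assume "\<not> length v' \<le> length w'"
    then have i: "length w' < length v'" by simp
    have "h a = k (v' ! length w')" if "a < m" for a
    proof -
      have "(\<lambda>_. a) \<in> cantor m" using that by (simp add: cantor_def)
      then have "h \<circ> conc w' (\<lambda>_. a) = k \<circ> conc v' (\<lambda>_. a)" using R by (metis row_def)
      then have "h (conc w' (\<lambda>_. a) (length w')) = k (conc v' (\<lambda>_. a) (length w'))"
        by (metis comp_apply)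
      then show ?thesis using i by (simp add: conc_def)
    qed
    from this[of 0] this[of 1] have "h 0 = h 1" using two_le_m by simp
    then show False using G_inject[of h 0 1] R(1) two_le_m by (simp add: row_def)
  qed
  then have len: "length w' = length v'" using assms by (meson le_antisym)
  have eq: "conc (map h w') (h \<circ> v) = conc (map k v') (k \<circ> v)" if "v \<in> cantor m" for v
    using assms that unfolding row_def by (metis comp_conc)
  have inj: "map h w' = map k v' \<and> h \<circ> v = k \<circ> v" if "v \<in> cantor m" for v
    using conc_inject[OF eq[OF that]] len by simp
  have "h a = k a" if "a < m" for a
    using inj[of "\<lambda>_. a"] that by (auto simp: cantor_def fun_eq_iff)
  then have hk: "h = k" using G_eqI assms by (simp add: row_def)
  have "inj_on h {..<m}" using assms(1) bij_betw_imp_inj_on[OF G_bij] by (simp add: row_def)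
  then have "inj_on h (set w' \<union> set v')"
    using assms by (auto simp: row_def fin_words_def intro: inj_on_subset)
  then have "w' = v'"
    using inj[OF zero_in_cantor] two_le_m hk by (simp add: inj_on_map_eq_map)
  with hk show ?thesis by simp
qed

text \<open>A pointwise substitute for a table: for every prescribed input label, rows exist around
  every point. Unlike a finite code, this refines freely.\<close>

definition covered :: "((nat \<Rightarrow> nat) \<Rightarrow> (nat \<Rightarrow> nat)) \<Rightarrow> bool" where
  "covered f \<longleftrightarrow> (\<forall>g\<in>G. \<forall>z\<in>cantor m. \<exists>w h w'. pref w z \<and> row f g w h w')"

lemma coveredE:
  assumes "covered f" "g \<in> G" "z \<in> cantor m"
  obtains w h w' where "pref w z" "row f g w h w'"
  using assms unfolding covered_def by blast

text \<open>Both input prefixes begin the same point, hence are comparable; the row with the shorter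
  one is subdivided.\<close>

lemma common_row:
  assumes "covered f" "covered f'" "g \<in> G" "z \<in> cantor m"
  obtains w h w' k v' where "pref w z" "row f g w h w'" "row f' g w k v'"
proof -
  obtain w h w' where r: "pref w z" "row f g w h w'"
    using coveredE[OF assms(1,3,4)] .
  obtain v k v' where r': "pref v z" "row f' g v k v'"
    using coveredE[OF assms(2,3,4)] .
  show ?thesis
  proof (cases "length v \<le> length w")
    case True
    then obtain u where u: "w = v @ u" using pref_prefix_extend[OF r'(1) r(1)] by blast
    then have "row f' g w k (v' @ u)" using row_extend[OF r'(2), of u] r(2) by (simp add: row_def)
    then show ?thesis using that r by blast
  next
    case False
    then obtain u where u: "v = w @ u" using pref_prefix_extend[OF r(1) r'(1)] by auto
    then have "row f g v h (w' @ u)" using row_extend[OF r(2), of u] r'(2) by (simp add: row_def)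
    then show ?thesis using that r' by blast
  qed
qed

text \<open>Follow \<open>z\<close> through a row of \<open>f\<close> and take a row of
  \<open>f'\<close> at the image. Of the output prefix \<open>w'\<close> and the input prefix
  \<open>s\<close>, the shorter one is extended to match the other.\<close>

lemma composable_rows:
  assumes "covered f" "covered f'" "g \<in> G" "z \<in> cantor m"
  obtains w h w' l w'' where "pref w z" "row f g w h w'" "row f' h w' l w''"
proof -
  obtain w h w' where r: "pref w z" "row f g w h w'"
    using coveredE[OF assms(1,3,4)] .
  define u where "u = (\<lambda>i. z (i + length w))"
  have z: "z = conc w u" using r(1) by (simp add: pref_iff u_def)
  have u: "u \<in> cantor m" using assms(4) by (simp add: u_def shift_in_cantor)
  have hG: "h \<in> G" and c: "conc w' u \<in> cantor m"
    using r(2) u by (auto simp: row_def conc_in_cantor_iff)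
  obtain s l s' where s: "pref s (conc w' u)" "row f' h s l s'"
    using coveredE[OF assms(2) hG c] .
  show ?thesis
  proof (cases "length s \<le> length w'")
    case True
    then obtain t where t: "w' = s @ t" using pref_prefix_extend[OF s(1) pref_conc] by blast
    then have "row f' h w' l (s' @ t)" using row_extend[OF s(2), of t] r(2) by (simp add: row_def)
    then show ?thesis using that r by blast
  next
    case False
    then obtain t where t: "s = w' @ t" using pref_prefix_extend[OF pref_conc s(1)] by auto
    \<comment> \<open>The excess \<open>t\<close> of \<open>s\<close> over \<open>w'\<close> also
      begins the tail \<open>u\<close> of \<open>z\<close>, so the row of \<open>f\<close> can be
      subdivided by \<open>t\<close> around \<open>z\<close>.\<close>
    have "conc w' u = conc w' (conc t (\<lambda>i. conc w' u (i + length s)))"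
      using s(1) t by (metis pref_iff conc_append)
    then have "u = conc t (\<lambda>i. conc w' u (i + length s))" using conc_inject by blast
    then have "pref (w @ t) z" using z by (metis conc_append pref_conc)
    moreover have "row f g (w @ t) h s"
      using row_extend[OF r(2), of t] s(2) t by (simp add: row_def)
    ultimately show ?thesis using that s(2) by blast
  qed
qed


section \<open>Elements of the symmetric Thompson group\<close>

lemma prefix_code_decompose:
  assumes "prefix_code m (set ps)" "length sigs = length ps" "set sigs \<subseteq> G" "z \<in> cantor m"
  obtains i u where "i < length ps" "u \<in> cantor m" "z = conc (ps ! i) (sigs ! i \<circ> u)"
proof -
  obtain i where i: "i < length ps" "pref (ps ! i) z"
    using assms(1,4) unfolding prefix_code_def by (metis in_set_conv_nth)
  have "sigs ! i \<in> G" using assms(2,3) i(1) by auto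
  then obtain u where "u \<in> cantor m" "(\<lambda>j. z (j + length (ps ! i))) = sigs ! i \<circ> u"
    using G_comp_surj shift_in_cantor[OF assms(4)] by blast
  then show ?thesis using that[OF i(1)] i(2) by (metis pref_iff)
qed

text \<open>Locate the table row containing \<open>g \<circ> z\<close>, then pull its input prefix
  back by \<open>g\<close> and its output prefix back by the label \<open>h\<close> from
  \<open>G_transport\<close>.\<close>

lemma Vset_covered:
  assumes "f \<in> Vset m G"
  shows "covered f"
  unfolding covered_def
proof (intro ballI)
  fix g z assume g: "g \<in> G" and z: "z \<in> cantor m"
  obtain ps qs sigs taus where T: "length qs = length ps" "length sigs = length ps"
    "length taus = length ps" "prefix_code m (set ps)" "prefix_code m (set qs)"
    "set sigs \<subseteq> G" "set taus \<subseteq> G"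
    "\<And>i u. i < length ps \<Longrightarrow> u \<in> cantor m \<Longrightarrow>
       f (conc (ps ! i) (sigs ! i \<circ> u)) = conc (qs ! i) (taus ! i \<circ> u)"
    using assms unfolding Vset_def by blast
  obtain i u where i: "i < length ps" "u \<in> cantor m" "g \<circ> z = conc (ps ! i) (sigs ! i \<circ> u)"
    using prefix_code_decompose[OF T(4,2,6) G_comp_cantor[OF g z]] .
  define w where "w = map z [0..<length (ps ! i)]"
  have "pref (ps ! i) (g \<circ> z)" using i(3) pref_conc by metis
  then have gw: "map g w = ps ! i" using pref_take by (metis map_map w_def)
  have st: "sigs ! i \<in> G" "taus ! i \<in> G" using T i(1) by auto
  obtain h where h: "h \<in> G"
    "\<And>v. v \<in> cantor m \<Longrightarrow> \<exists>u\<in>cantor m. g \<circ> v = sigs ! i \<circ> u \<and> h \<circ> v = taus ! i \<circ> u"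
    using G_transport[OF g st] by blast
  have "qs ! i \<in> fin_words m"
    using T(1,5) i(1) unfolding prefix_code_def by (metis nth_mem subsetD)
  then obtain w' where w': "w' \<in> fin_words m" "map h w' = qs ! i"
    using G_map_surj[OF h(1)] by blast
  have "f (g \<circ> conc w v) = h \<circ> conc w' v" if "v \<in> cantor m" for v
    using h(2)[OF that] T(8)[OF i(1)] gw w' by (auto simp: comp_conc)
  then have "row f g w h w'"
    using g h w' take_in_fin_words[OF z] by (simp add: row_def w_def)
  moreover have "pref w z" by (simp add: pref_def w_def)
  ultimately show "\<exists>w h w'. pref w z \<and> row f g w h w'" by blast
qed

text \<open>Exchanging the two columns of the table describes the inverse map. Bijectivity of
  \<open>f\<close> is first derived from the two codes.\<close>

lemma Vset_inverse:
  assumes "f \<in> Vset m G"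
  obtains f' where "f' \<in> Vset m G"
    "compose (cantor m) f' f = (\<lambda>z\<in>cantor m. z)" "compose (cantor m) f f' = (\<lambda>z\<in>cantor m. z)"
proof -
  obtain ps qs sigs taus where T: "length qs = length ps" "length sigs = length ps"
    "length taus = length ps" "distinct ps" "distinct qs"
    "prefix_code m (set ps)" "prefix_code m (set qs)"
    "set sigs \<subseteq> G" "set taus \<subseteq> G"
    and row: "\<And>i u. i < length ps \<Longrightarrow> u \<in> cantor m \<Longrightarrow>
       f (conc (ps ! i) (sigs ! i \<circ> u)) = conc (qs ! i) (taus ! i \<circ> u)"
    using assms unfolding Vset_def by blast
  have len: "length sigs = length qs" "length taus = length qs" using T by auto
  have G: "sigs ! i \<in> G" "taus ! i \<in> G" if "i < length ps" for i
    using T that by auto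
  have fin: "ps ! i \<in> fin_words m" "qs ! i \<in> fin_words m" if "i < length ps" for i
    using T(1,6,7) that unfolding prefix_code_def by (metis nth_mem subsetD)+
  have inC: "conc (ps ! i) (sigs ! i \<circ> u) \<in> cantor m" "conc (qs ! i) (taus ! i \<circ> u) \<in> cantor m"
    if "i < length ps" "u \<in> cantor m" for i u
    using that G fin by (simp_all add: conc_in_cantor_iff G_comp_cantor)
  have "bij_betw f (cantor m) (cantor m)"
  proof (rule bij_betwI')
    fix z z' assume z: "z \<in> cantor m" "z' \<in> cantor m"
    obtain i u where i: "i < length ps" "u \<in> cantor m" "z = conc (ps ! i) (sigs ! i \<circ> u)"
      using prefix_code_decompose[OF T(6,2,8) z(1)] .
    obtain j v where j: "j < length ps" "v \<in> cantor m" "z' = conc (ps ! j) (sigs ! j \<circ> v)"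
      using prefix_code_decompose[OF T(6,2,8) z(2)] .
    show "f z = f z' \<longleftrightarrow> z = z'"
    proof
      assume "f z = f z'"
      then have eq: "conc (qs ! i) (taus ! i \<circ> u) = conc (qs ! j) (taus ! j \<circ> v)"
        using row i j by simp
      \<comment> \<open>The range code determines the output prefix, and distinctness of
        \<open>qs\<close> then determines the row.\<close>
      have "\<exists>!s. s \<in> set qs \<and> pref s (conc (qs ! i) (taus ! i \<circ> u))"
        using T(7) inC i unfolding prefix_code_def by blast
      then have "qs ! i = qs ! j"
        using eq i(1) j(1) T(1) pref_conc by (metis nth_mem)
      then have ij: "i = j" using T(1,5) i(1) j(1) by (simp add: nth_eq_iff_index_eq)
      then have "taus ! i \<circ> u = taus ! i \<circ> v" using eq conc_inject by blast
      then have "u = v" using G_comp_inject G i j by blast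
      then show "z = z'" using i j ij by simp
    qed simp
  next
    fix z assume z: "z \<in> cantor m"
    obtain i u where i: "i < length ps" "u \<in> cantor m" "z = conc (ps ! i) (sigs ! i \<circ> u)"
      using prefix_code_decompose[OF T(6,2,8) z] .
    then show "f z \<in> cantor m" using row inC by simp
  next
    fix z assume z: "z \<in> cantor m"
    obtain i u where i: "i < length qs" "u \<in> cantor m" "z = conc (qs ! i) (taus ! i \<circ> u)"
      using prefix_code_decompose[OF T(7) len(2) T(9) z] .
    then show "\<exists>x\<in>cantor m. z = f x" using row inC T(1) by metis
  qed
  note bij = this
  let ?f = "\<lambda>z\<in>cantor m. inv_into (cantor m) f z"
  have "?f (conc (qs ! i) (taus ! i \<circ> u)) = conc (ps ! i) (sigs ! i \<circ> u)"
    if "i < length qs" "u \<in> cantor m" for i u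
    using that row inC T(1) bij_betw_inv_into_left[OF bij] by (metis restrict_apply')
  then have "?f \<in> Vset m G"
    unfolding Vset_def
    by (intro CollectI conjI exI[of _ qs] exI[of _ ps] exI[of _ taus] exI[of _ sigs])
      (use T in auto)
  moreover have "compose (cantor m) ?f f = (\<lambda>z\<in>cantor m. z)"
    using bij_betwE[OF bij] bij_betw_inv_into_left[OF bij]
    by (auto simp: compose_def fun_eq_iff)
  moreover have "compose (cantor m) f ?f = (\<lambda>z\<in>cantor m. z)"
    using bij_betw_inv_into_right[OF bij] by (auto simp: compose_def fun_eq_iff)
  ultimately show ?thesis using that by blast
qed


section \<open>The lifted action\<close>

text \<open>The label is the value table of \<open>g\<close>. Its fixed length \<open>m\<close>
  makes different labels incomparable as prefixes, and \<open>m \<le> n\<close> makes it a word over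
  the larger alphabet.\<close>

definition code :: "(nat \<Rightarrow> nat) \<Rightarrow> (nat \<Rightarrow> nat) \<Rightarrow> (nat \<Rightarrow> nat)" where
  "code g y = conc (map g [0..<m]) y"

definition X :: "(nat \<Rightarrow> nat) set" where
  "X = {code g y | g y. g \<in> G \<and> y \<in> Y}"

lemma code_inject:
  assumes "code g y = code h z" "g \<in> G" "h \<in> G"
  shows "g = h \<and> y = z"
proof -
  have "map g [0..<m] = map h [0..<m] \<and> y = z"
    using conc_inject[OF assms(1)[unfolded code_def]] by simp
  then show ?thesis using G_eqI assms(2,3) by simp
qed

lemma code_in_cantor: "g \<in> G \<Longrightarrow> y \<in> Y \<Longrightarrow> code g y \<in> cantor n"
  using m_le_n G_less by (force simp: code_def conc_in_cantor_iff stump_def fin_words_def)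

lemma code_in_X: "g \<in> G \<Longrightarrow> y \<in> Y \<Longrightarrow> code g y \<in> X"
  by (auto simp: X_def)

lemma X_subset: "X \<subseteq> cantor n"
  by (auto simp: X_def code_in_cantor)

text \<open>The first \<open>m\<close> letters hold the label and the letter at index
  \<open>m\<close> decides membership in the stump, so \<open>X\<close> is clopen.\<close>

lemma X_prefix_determined:
  assumes "x \<in> X" "x' \<in> cantor n" "\<And>i. i \<le> m \<Longrightarrow> x' i = x i"
  shows "x' \<in> X"
proof -
  obtain g y where gy: "x = code g y" "g \<in> G" "y \<in> Y" using assms(1) by (auto simp: X_def)
  have "pref (map g [0..<m]) x'"
    using gy(1) assms(3) by (simp add: pref_def code_def conc_nth)
  then have "x' = code g (\<lambda>i. x' (i + m))" by (simp add: pref_iff code_def)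
  moreover have "(\<lambda>i. x' (i + m)) \<in> Y"
    using gy assms(3)[of m] shift_in_cantor[OF assms(2), of m]
    by (simp add: stump_def code_def conc_def)
  ultimately show ?thesis using code_in_X gy(2) by metis
qed

text \<open>No row is chosen; \<open>lift_row\<close> shows that all rows through \<open>x\<close>
  give the same value.\<close>

definition lift :: "((nat \<Rightarrow> nat) \<Rightarrow> (nat \<Rightarrow> nat)) \<Rightarrow> (nat \<Rightarrow> nat) \<Rightarrow> (nat \<Rightarrow> nat)" where
  "lift f = (\<lambda>x\<in>cantor n. if x \<in> X then
     THE x'. \<exists>g w h w' y. row f g w h w' \<and> y \<in> Y \<and>
       x = code g (branches w y) \<and> x' = code h (branches w' y)
     else x)"

text \<open>Two rows through one point share the label \<open>g\<close> and have comparable words.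
  Extending the shorter row to the longer word and applying \<open>row_unique\<close> identifies the
  outputs.\<close>

lemma lift_row:
  assumes "row f g w h w'" "y \<in> Y"
  shows "lift f (code g (branches w y)) = code h (branches w' y)"
proof -
  have aux: "h = k \<and> branches w' y = branches v' z"
    if r: "row f g w h w'" "row f g v k v'" "branches w y = branches v z" "y \<in> Y" "z \<in> Y"
      "length w \<le> length v" for w h w' v k v' y z
  proof -
    have "w \<in> fin_words m" "v \<in> fin_words m" using r by (auto simp: row_def)
    then obtain u where u: "v = w @ u" "y = branches u z" "u \<in> fin_words m"
      using branches_comparable[OF r(3,4,5) _ _ r(6)] by blast
    have "h = k \<and> w' @ u = v'" using row_extend[OF r(1) u(3)] r(2) u(1) row_unique by blast
    then show ?thesis using u(2) by auto
  qed
  have G: "g \<in> G" "branches w y \<in> Y" using assms branches_in by (auto simp: row_def)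
  have "(THE x'. \<exists>g' v k v' z. row f g' v k v' \<and> z \<in> Y \<and>
      code g (branches w y) = code g' (branches v z) \<and> x' = code k (branches v' z))
    = code h (branches w' y)"
  proof (rule the_equality)
    show "\<exists>g' v k v' z. row f g' v k v' \<and> z \<in> Y \<and> code g (branches w y) = code g' (branches v z) \<and>
      code h (branches w' y) = code k (branches v' z)"
      using assms by blast
    fix x' assume "\<exists>g' v k v' z. row f g' v k v' \<and> z \<in> Y \<and>
      code g (branches w y) = code g' (branches v z) \<and> x' = code k (branches v' z)"
    then obtain g' v k v' z where r: "row f g' v k v'" "z \<in> Y"
      "code g (branches w y) = code g' (branches v z)" "x' = code k (branches v' z)" by blast
    have g': "g' = g" "branches w y = branches v z"
      using code_inject[OF r(3) G(1)] r(1) by (auto simp: row_def)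
    have "h = k \<and> branches w' y = branches v' z"
    proof (cases "length w \<le> length v")
      case True
      then show ?thesis using aux assms r g' by blast
    next
      case False
      then have "k = h \<and> branches v' z = branches w' y"
        using assms r g' by (intro aux[of v k v' w h w']) auto
      then show ?thesis by auto
    qed
    then show "x' = code h (branches w' y)" using r(4) by simp
  qed
  then show ?thesis
    using G code_in_X code_in_cantor by (simp add: lift_def)
qed

lemma lift_outside: "x \<in> cantor n \<Longrightarrow> x \<notin> X \<Longrightarrow> lift f x = x"
  by (simp add: lift_def)

text \<open>The itinerary \<open>z\<close> carries coverings of \<open>cantor m\<close> by prefixes
  over to points of \<open>X\<close>.\<close>

lemma X_pointE:
  assumes "x \<in> X"
  obtains g z where "g \<in> G" "z \<in> cantor m"
    "\<And>w. pref w z \<Longrightarrow> \<exists>y\<in>Y. x = code g (branches w y)"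
proof -
  obtain g y where gy: "x = code g y" "g \<in> G" "y \<in> Y" using assms by (auto simp: X_def)
  obtain z where "z \<in> cantor m" "\<And>w. pref w z \<Longrightarrow> \<exists>y'\<in>Y. y = branches w y'"
    using branches_itinerary[OF gy(3)] by blast
  then show ?thesis using that gy by blast
qed

lemma X_rowE:
  assumes "covered f" "x \<in> X"
  obtains g w h w' y where "row f g w h w'" "y \<in> Y" "x = code g (branches w y)"
proof -
  obtain g z where gz: "g \<in> G" "z \<in> cantor m"
    "\<And>w. pref w z \<Longrightarrow> \<exists>y\<in>Y. x = code g (branches w y)"
    using X_pointE[OF assms(2)] by blast
  show ?thesis using coveredE[OF assms(1) gz(1,2)] gz(3) that by metis
qed

lemma lift_in_X:
  assumes "covered f" "x \<in> X"
  shows "lift f x \<in> X"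
proof -
  obtain g w h w' y where r: "row f g w h w'" "y \<in> Y" "x = code g (branches w y)"
    using X_rowE[OF assms] .
  then have "lift f x = code h (branches w' y)" using lift_row by simp
  then show ?thesis using r code_in_X branches_in by (simp add: row_def)
qed

lemma lift_in_cantor: "covered f \<Longrightarrow> x \<in> cantor n \<Longrightarrow> lift f x \<in> cantor n"
  using lift_in_X lift_outside X_subset by (metis subsetD)

lemma lift_compose:
  assumes "covered f" "covered f'"
  shows "lift (compose (cantor m) f' f) = compose (cantor n) (lift f') (lift f)"
proof
  fix x
  show "lift (compose (cantor m) f' f) x = compose (cantor n) (lift f') (lift f) x"
  proof (cases "x \<in> X")
    case True
    obtain g z where gz: "g \<in> G" "z \<in> cantor m"
      "\<And>w. pref w z \<Longrightarrow> \<exists>y\<in>Y. x = code g (branches w y)"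
      using X_pointE[OF True] by blast
    obtain w h w' l w'' where r: "pref w z" "row f g w h w'" "row f' h w' l w''"
      using composable_rows[OF assms gz(1,2)] .
    obtain y where y: "y \<in> Y" "x = code g (branches w y)" using gz(3) r(1) by blast
    show ?thesis
      using lift_row[OF r(2) y(1)] lift_row[OF r(3) y(1)] lift_row[OF row_compose[OF r(2,3)] y(1)]
        y(2) True X_subset by (auto simp: compose_def)
  next
    case False
    then show ?thesis by (auto simp: lift_def compose_def)
  qed
qed

lemma lift_id: "lift (\<lambda>z\<in>cantor m. z) = (\<lambda>x\<in>cantor n. x)"
proof
  fix x
  show "lift (\<lambda>z\<in>cantor m. z) x = (\<lambda>x\<in>cantor n. x) x"
  proof (cases "x \<in> X")
    case True
    then obtain g y where gy: "x = code g y" "g \<in> G" "y \<in> Y" by (auto simp: X_def)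
    \<comment> \<open>The identity is a single row with empty prefixes for each label.\<close>
    have "row (\<lambda>z\<in>cantor m. z) g [] g []" using gy(2) by (simp add: row_def G_comp_cantor)
    from lift_row[OF this gy(3)] show ?thesis using gy True X_subset by auto
  next
    case False
    then show ?thesis by (auto simp: lift_def)
  qed
qed

text \<open>The lift of the inverse gives bijectivity. Locally, a row acts on \<open>X\<close> by
  prefix replacement once the first letter of the stump point is fixed, and off \<open>X\<close> the
  map is the identity.\<close>

lemma lift_in_Vset:
  assumes "f \<in> Vset m G" "(\<lambda>i\<in>{..<n}. i) \<in> H"
  shows "lift f \<in> Vset n H"
proof (rule Vset_if_local[OF _ _ _ assms(2)])
  show "0 < n" using two_le_m m_le_n by simp
  show "lift f \<in> extensional (cantor n)" by (simp add: lift_def)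
  have cov: "covered f" using Vset_covered assms(1) .
  obtain f' where f': "f' \<in> Vset m G"
    "compose (cantor m) f' f = (\<lambda>z\<in>cantor m. z)" "compose (cantor m) f f' = (\<lambda>z\<in>cantor m. z)"
    using Vset_inverse[OF assms(1)] .
  have cov': "covered f'" using Vset_covered f'(1) .
  have inv: "lift f' (lift f x) = x" "lift f (lift f' x) = x" if "x \<in> cantor n" for x
    using lift_compose[OF cov cov'] lift_compose[OF cov' cov] f' lift_id that
    by (metis compose_eq restrict_apply')+
  show "bij_betw (lift f) (cantor n) (cantor n)"
    by (rule bij_betwI[of _ _ _ "lift f'"]) (use inv lift_in_cantor cov cov' in auto)
  fix x assume x: "x \<in> cantor n"
  show "\<exists>p q. pref p x \<and> (\<forall>u\<in>cantor n. lift f (conc p u) = conc q u)"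
  proof (cases "x \<in> X")
    case True
    obtain g w h w' y where r: "row f g w h w'" "y \<in> Y" "x = code g (branches w y)"
      using X_rowE[OF cov True] .
    \<comment> \<open>The whole cone of \<open>y 0\<close> then lies in \<open>Y\<close>, so the
      same row applies on all of it.\<close>
    have c: "y 0 < n - 1" using r(2) cantor_less[of y n 0] by (auto simp: stump_def)
    have ww: "w \<in> fin_words m" "w' \<in> fin_words m" using r(1) by (auto simp: row_def)
    obtain t t' where t: "\<And>u. u \<in> cantor n \<Longrightarrow> branches w (conc [y 0] u) = conc t u"
      "\<And>u. u \<in> cantor n \<Longrightarrow> branches w' (conc [y 0] u) = conc t' u"
      using branches_prefix_replacement[OF c ww(1)] branches_prefix_replacement[OF c ww(2)]
      by metis
    let ?p = "map g [0..<m] @ t" and ?q = "map h [0..<m] @ t'"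
    have "lift f (conc ?p u) = conc ?q u" if "u \<in> cantor n" for u
    proof -
      have "conc [y 0] u \<in> Y" using c that by (simp add: stump_def conc_in_cantor_iff)
      from lift_row[OF r(1) this] show ?thesis using t that by (simp add: code_def conc_append)
    qed
    moreover have "(\<lambda>i. y (Suc i)) \<in> cantor n"
      using r(2) by (simp add: stump_def shift_Suc_in_cantor)
    then have "x = conc ?p (\<lambda>i. y (Suc i))"
      using r(3) t(1) conc_shift_Suc[of y] by (metis code_def conc_append)
    then have "pref ?p x" using pref_conc by metis
    ultimately show ?thesis by blast
  next
    case False
    \<comment> \<open>These \<open>m + 1\<close> letters already decide membership in
      \<open>X\<close>.\<close>
    let ?p = "map x [0..<Suc m]"
    have "lift f (conc ?p u) = conc ?p u" if "u \<in> cantor n" for u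
    proof (rule lift_outside)
      show mem: "conc ?p u \<in> cantor n"
        using take_in_fin_words[OF x] that by (simp only: conc_in_cantor_iff)
      have "x i = conc ?p u i" if "i \<le> m" for i
        using that by (simp add: conc_def del: upt_Suc)
      then show "conc ?p u \<notin> X" using X_prefix_determined[of "conc ?p u" x] False x by blast
    qed
    moreover have "pref ?p x" by (simp add: pref_def del: upt_Suc)
    ultimately show ?thesis by blast
  qed
qed

text \<open>Rows with the identity as input label suffice to recover \<open>f\<close>: equal lifts
  force equal output labels by \<open>code_inject\<close> and equal output words by
  \<open>branches_eqD\<close>.\<close>

lemma lift_inj: "inj_on lift (Vset m G)"
proof (rule inj_onI)
  fix f f' assume f: "f \<in> Vset m G" "f' \<in> Vset m G" and eq: "lift f = lift f'"
  have ext: "f \<in> extensional (cantor m)" "f' \<in> extensional (cantor m)"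
    using f by (auto simp: Vset_def)
  show "f = f'"
  proof (rule extensionalityI[OF ext])
    fix z assume z: "z \<in> cantor m"
    let ?e = "\<lambda>i\<in>{..<m}. i"
    obtain w h w' k v' where r: "pref w z" "row f ?e w h w'" "row f' ?e w k v'"
      using common_row[OF Vset_covered[OF f(1)] Vset_covered[OF f(2)] one_in_G z] .
    have hk: "h = k \<and> branches w' y = branches v' y" if "y \<in> Y" for y
      using code_inject[of h "branches w' y" k "branches v' y"] lift_row[OF r(2) that]
        lift_row[OF r(3) that] eq r by (simp add: row_def)
    then have "w' = v'" using branches_eqD[of w' v'] r by (simp add: row_def)
    moreover have "h = k" using hk Y_point by blast
    moreover have "z = ?e \<circ> conc w (\<lambda>i. z (i + length w))"
      using one_comp[OF z] r(1) by (metis pref_iff)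
    ultimately show "f z = f' z"
      using r(2,3) shift_in_cantor[OF z] unfolding row_def by metis
  qed
qed

lemma lift_hom:
  assumes "(\<lambda>i\<in>{..<n}. i) \<in> H"
  shows "lift \<in> hom (Vgroup m G) (Vgroup n H)"
proof (rule homI)
  fix f assume "f \<in> carrier (Vgroup m G)"
  then show "lift f \<in> carrier (Vgroup n H)"
    using lift_in_Vset[OF _ assms] by (simp add: Vgroup_def)
next
  fix f f' assume "f \<in> carrier (Vgroup m G)" "f' \<in> carrier (Vgroup m G)"
  then show "lift (f \<otimes>\<^bsub>Vgroup m G\<^esub> f') = lift f \<otimes>\<^bsub>Vgroup n H\<^esub> lift f'"
    using lift_compose[OF Vset_covered Vset_covered, of f' f] by (simp add: Vgroup_def)
qed

end

theorem theorem1p2: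
  fixes m n k :: nat and G :: "(nat \<Rightarrow> nat) set"
  assumes "m \<ge> 2" and "n \<ge> 2" and "k \<ge> 1" and "n = k * (m - 1) + m"
    and "subgroup G (BijGroup {..<m})"
  shows "\<exists>\<phi>. \<phi> \<in> hom (Vgroup m G) (Vgroup n (ext_group m n G))
             \<and> inj_on \<phi> (carrier (Vgroup m G))"
proof -
  interpret thompson_embedding m n G
    using assms by (intro thompson_embedding.intro) auto
  \<comment> \<open>The identity of \<open>G\<close> extends to the identity on \<open>n\<close>
    letters, the permutation used in the lifted tables.\<close>
  have "(\<lambda>i\<in>{..<n}. i) \<in> ext_group m n G"
    using one_in_G m_le_n
    by (auto simp: ext_group_def id_Bij intro!: bexI[of _ "\<lambda>i\<in>{..<m}. i"])
  then show ?thesis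
    using lift_hom lift_inj by (auto simp: Vgroup_def)
qed

end
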